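(* Assume that the third-order ODEs $u'''=f(x,u,u',u'')$ and $\bar u'''=\bar f(\bar x,\bar u,\bar u',\bar u'')$ are equivalent with respect to a point transformation $$\bar x=\varphi(x,u),\qquad \bar u=\psi(x,u),\qquad \varphi_x\psi_u-\varphi_u\psi_x\neq0,$$ and let $\Phi^*$ denote the pullback defined by the second prolongation of this transformation. Suppose given an invariant four-dimensional coframe on the second-order jet space such that $$ \Phi^*\left[ \begin{pmatrix}\bar a_1&0&0&0\\ \bar a_2&\bar a_3&0&0\\ \bar a_4&\bar a_5&\bar a_6&0\\ \bar a_7&0&0&\bar a_9\end{pmatrix} \begin{pmatrix}d\bar u-\bar p\,d\bar x\\ d\bar p-\bar q\,d\bar x\\ d\bar q-\bar f\,d\bar x\\ d\bar x\end{pmatrix}\right] = \begin{pmatrix}a_1&0&0&0\\ a_2&a_3&0&0\\ a_4&a_5&a_6&0\\ a_7&0&0&a_9\end{pmatrix} \begin{pmatrix}du-p\,dx\\ dp-q\,dx\\ dq-f\,dx\\ dx\end{pmatrix} $$ for some functions $a_i(x,u,p,q)$ and corresponding $\bar a_i(\bar x,\bar u,\bar p,\bar q)$, $i=1,2,3,4,5,6,7,9$. Define $$ \begin{pmatrix}b_1&0&0&0\\ b_2&b_3&0&0\\ b_4&b_5&b_6&0\\ b_7&0&0&b_9\end{pmatrix} = \begin{pmatrix}\bar a_1&0&0&0\\ \bar a_2&\bar a_3&0&0\\ \bar a_4&\bar a_5&\bar a_6&0\\ \bar a_7&0&0&\bar a_9\end{pmatrix}^{-1} \begin{pmatrix}a_1&0&0&0\\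 a_2&a_3&0&0\\ a_4&a_5&a_6&0\\ a_7&0&0&a_9\end{pmatrix}, $$ where the $\bar a_i$ are evaluated at $(\bar x,\bar u,\bar p,\bar q)=(\varphi,\psi,\chi,\eta)$. Then the following system determines the point transformation between the two third-order ODEs: $$ \begin{aligned} &\hat D_x\eta=b_9\bar f,\quad \eta_u=b_4+b_7\bar f,\quad \eta_p=b_5,\quad \eta_q=b_6,\\ &\hat D_x\chi=b_9\eta,\quad \chi_u=b_2+b_7\eta,\quad \chi_p=b_3,\\ &\hat D_x\varphi=b_9,\quad \varphi_u=b_7,\\ &b_7\hat D_x\psi=b_9(\psi_u-b_1), \end{aligned} $$ where $$\chi=\frac{\hat D_x\psi}{\hat D_x\varphi},\qquad \eta=\frac{\hat D_x\chi}{\hat D_x\varphi},\qquad \bar f=\frac{\hat D_x\eta}{\hat D_x\varphi}$$ (the last being $\bar f$ evaluated at $(\varphi,\psi,\chi,\eta)$).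
   Context: Everything is local. $(x,u,p,q)$, with $p=u'$, $q=u''$, are local coordinates on the second-order jet space, and similarly $(\bar x,\bar u,\bar p,\bar q)$ with $\bar p=\bar u'$, $\bar q=\bar u''$. Put $\hat D_x=\partial_x+p\,\partial_u+q\,\partial_p+f\,\partial_q$; letter subscripts denote partial derivatives. The second prolongation of the point transformation is $(x,u,p,q)\mapsto(\varphi,\psi,\chi,\eta)$ with $\chi=\hat D_x\psi/\hat D_x\varphi$ and $\eta=\hat D_x\chi/\hat D_x\varphi$. Both coefficient matrices are invertible, i.e. $a_1a_3a_6a_9\ne0$ and $\bar a_1\bar a_3\bar a_6\bar a_9\neq0$. *)

theory Defs
  imports "HOL-Analysis.Analysis"
begin

type_synonym plane = "real \<times> real"                    (* (x, u) *)
type_synonym jet = "real \<times> real \<times> real \<times> real"        (* (x, u, p, q) *)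

text \<open>On open subsets of a finite-dimensional space this is the usual notion of class C^k.\<close>

primrec C_k_on :: "nat \<Rightarrow> ('a::euclidean_space \<Rightarrow> real) \<Rightarrow> 'a set \<Rightarrow> bool" where
  "C_k_on 0 F S \<longleftrightarrow> continuous_on S F"
| "C_k_on (Suc k) F S \<longleftrightarrow>
     F differentiable_on S \<and> (\<forall>v. C_k_on k (\<lambda>z. frechet_derivative F (at z) v) S)"

definition smooth_on :: "'a::euclidean_space set \<Rightarrow> ('a \<Rightarrow> real) \<Rightarrow> bool" where
  "smooth_on S F \<longleftrightarrow> (\<forall>k. C_k_on k F S)"

definition d_x :: "(jet \<Rightarrow> real) \<Rightarrow> jet \<Rightarrow> real" where
  "d_x F = (\<lambda>(x,u,p,q). deriv (\<lambda>t. F (t,u,p,q)) x)"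

definition d_u :: "(jet \<Rightarrow> real) \<Rightarrow> jet \<Rightarrow> real" where
  "d_u F = (\<lambda>(x,u,p,q). deriv (\<lambda>t. F (x,t,p,q)) u)"

definition d_p :: "(jet \<Rightarrow> real) \<Rightarrow> jet \<Rightarrow> real" where
  "d_p F = (\<lambda>(x,u,p,q). deriv (\<lambda>t. F (x,u,t,q)) p)"

definition d_q :: "(jet \<Rightarrow> real) \<Rightarrow> jet \<Rightarrow> real" where
  "d_q F = (\<lambda>(x,u,p,q). deriv (\<lambda>t. F (x,u,p,t)) q)"

definition Dhat :: "(jet \<Rightarrow> real) \<Rightarrow> (jet \<Rightarrow> real) \<Rightarrow> jet \<Rightarrow> real" where
  "Dhat f F = (\<lambda>(x,u,p,q). d_x F (x,u,p,q) + p * d_u F (x,u,p,q)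
                          + q * d_p F (x,u,p,q) + f (x,u,p,q) * d_q F (x,u,p,q))"

definition base :: "jet \<Rightarrow> plane" where
  "base = (\<lambda>(x,u,p,q). (x,u))"

definition lift :: "(plane \<Rightarrow> real) \<Rightarrow> jet \<Rightarrow> real" where
  "lift g = (\<lambda>z. g (base z))"

definition point_transformation ::
    "plane set \<Rightarrow> (plane \<Rightarrow> real) \<Rightarrow> (plane \<Rightarrow> real) \<Rightarrow> bool" where
  "point_transformation W \<phi> \<psi> \<longleftrightarrow> smooth_on W \<phi> \<and> smooth_on W \<psi> \<and>
     (\<forall>(x,u)\<in>W. deriv (\<lambda>t. \<phi> (t,u)) x * deriv (\<lambda>t. \<psi> (x,t)) u
               - deriv (\<lambda>t. \<phi> (x,t)) u * deriv (\<lambda>t. \<psi> (t,u)) x \<noteq> 0)"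

text \<open>As in the classical formulas, \<open>f\<close> enters through the total derivative; it has no effect on
  the values, since \<open>\<phi>\<close>, \<open>\<psi>\<close> do not depend on p, q, and \<open>chi\<close> does not depend on q.\<close>

definition chi ::
    "(jet \<Rightarrow> real) \<Rightarrow> (plane \<Rightarrow> real) \<Rightarrow> (plane \<Rightarrow> real) \<Rightarrow> jet \<Rightarrow> real" where
  "chi f \<phi> \<psi> = (\<lambda>z. Dhat f (lift \<psi>) z / Dhat f (lift \<phi>) z)"

definition eta ::
    "(jet \<Rightarrow> real) \<Rightarrow> (plane \<Rightarrow> real) \<Rightarrow> (plane \<Rightarrow> real) \<Rightarrow> jet \<Rightarrow> real" where
  "eta f \<phi> \<psi> = (\<lambda>z. Dhat f (chi f \<phi> \<psi>) z / Dhat f (lift \<phi>) z)"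

definition prolong ::
    "(jet \<Rightarrow> real) \<Rightarrow> (plane \<Rightarrow> real) \<Rightarrow> (plane \<Rightarrow> real) \<Rightarrow> jet \<Rightarrow> jet" where
  "prolong f \<phi> \<psi> = (\<lambda>z. (lift \<phi> z, lift \<psi> z, chi f \<phi> \<psi> z, eta f \<phi> \<psi> z))"

text \<open>The second prolongation is defined on all of \<open>U\<close> and maps it into \<open>Ubar\<close>.\<close>

definition prolongs_into ::
    "(jet \<Rightarrow> real) \<Rightarrow> (plane \<Rightarrow> real) \<Rightarrow> (plane \<Rightarrow> real) \<Rightarrow> jet set \<Rightarrow> jet set \<Rightarrow> bool" where
  "prolongs_into f \<phi> \<psi> U Ubar \<longleftrightarrow>
     (\<forall>z\<in>U. Dhat f (lift \<phi>) z \<noteq> 0 \<and> prolong f \<phi> \<psi> z \<in> Ubar)"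

definition jet2 :: "(real \<Rightarrow> real) \<Rightarrow> real \<Rightarrow> jet" where
  "jet2 u t = (t, u t, deriv u t, deriv (deriv u) t)"

definition curve_in :: "jet set \<Rightarrow> real set \<Rightarrow> (real \<Rightarrow> real) \<Rightarrow> bool" where
  "curve_in U I u \<longleftrightarrow> open I \<and> is_interval I \<and>
     (\<forall>t\<in>I. u differentiable (at t) \<and> deriv u differentiable (at t) \<and>
            deriv (deriv u) differentiable (at t) \<and> jet2 u t \<in> U)"

definition ode_solution ::
    "(jet \<Rightarrow> real) \<Rightarrow> jet set \<Rightarrow> real set \<Rightarrow> (real \<Rightarrow> real) \<Rightarrow> bool" where
  "ode_solution f U I u \<longleftrightarrow>
     curve_in U I u \<and> (\<forall>t\<in>I. deriv (deriv (deriv u)) t = f (jet2 u t))"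

text \<open>A curve u = u(x) solves the first equation iff its image under \<open>(\<phi>, \<psi>)\<close> is the graph of a
  solution \<open>v\<close> of the second one.\<close>

definition ode_equivalent ::
    "(jet \<Rightarrow> real) \<Rightarrow> jet set \<Rightarrow> (jet \<Rightarrow> real) \<Rightarrow> jet set
     \<Rightarrow> (plane \<Rightarrow> real) \<Rightarrow> (plane \<Rightarrow> real) \<Rightarrow> bool" where
  "ode_equivalent f U fbar Ubar \<phi> \<psi> \<longleftrightarrow>
     (\<forall>I u. curve_in U I u \<longrightarrow>
        (ode_solution f U I u \<longleftrightarrow>
          (\<exists>v. (\<forall>t\<in>I. v (\<phi> (t, u t)) = \<psi> (t, u t)) \<and>
               ode_solution fbar Ubar ((\<lambda>t. \<phi> (t, u t)) ` I) v)))"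

text \<open>The coefficients are indexed 1, ..., 7, 9; the index 8 is not used.\<close>

definition cofmat :: "(nat \<Rightarrow> real) \<Rightarrow> real^4^4" where
  "cofmat c = vector [vector [c 1,   0,   0,   0],
                      vector [c 2, c 3,   0,   0],
                      vector [c 4, c 5, c 6,   0],
                      vector [c 7,   0,   0, c 9]]"

text \<open>The inverse encoding: it reads off the coefficients at the positions used by \<open>cofmat\<close>.\<close>

definition cofentry :: "real^4^4 \<Rightarrow> nat \<Rightarrow> real" where
  "cofentry B i =
     (if i = 1 then B $ 1 $ 1 else
      if i = 2 then B $ 2 $ 1 else if i = 3 then B $ 2 $ 2 else
      if i = 4 then B $ 3 $ 1 else if i = 5 then B $ 3 $ 2 else if i = 6 then B $ 3 $ 3 else
      if i = 7 then B $ 4 $ 1 else if i = 9 then B $ 4 $ 4 else 0)"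

text \<open>A 1-form is given at a point \<open>z\<close> by its values on the tangent vectors
  \<open>(dx, du, dp, dq)\<close>; a coframe is the vector of its four 1-forms.\<close>

definition contact_coframe :: "(jet \<Rightarrow> real) \<Rightarrow> jet \<Rightarrow> jet \<Rightarrow> real^4" where
  "contact_coframe f = (\<lambda>(x,u,p,q) (dx,du,dp,dq).
     vector [du - p * dx, dp - q * dx, dq - f (x,u,p,q) * dx, dx])"

definition coframe ::
    "(jet \<Rightarrow> real) \<Rightarrow> (nat \<Rightarrow> jet \<Rightarrow> real) \<Rightarrow> jet \<Rightarrow> jet \<Rightarrow> real^4" where
  "coframe f a z h = cofmat (\<lambda>i. a i z) *v contact_coframe f z h"

definition pullback :: "(jet \<Rightarrow> jet) \<Rightarrow> (jet \<Rightarrow> jet \<Rightarrow> real^4) \<Rightarrow> jet \<Rightarrow> jet \<Rightarrow> real^4" where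
  "pullback \<Phi> \<theta> z h = \<theta> (\<Phi> z) (frechet_derivative \<Phi> (at z) h)"

definition coframes_match ::
    "(jet \<Rightarrow> real) \<Rightarrow> jet set \<Rightarrow> (jet \<Rightarrow> real) \<Rightarrow> (nat \<Rightarrow> jet \<Rightarrow> real) \<Rightarrow> (nat \<Rightarrow> jet \<Rightarrow> real)
     \<Rightarrow> (plane \<Rightarrow> real) \<Rightarrow> (plane \<Rightarrow> real) \<Rightarrow> bool" where
  "coframes_match f U fbar a abar \<phi> \<psi> \<longleftrightarrow>
     (\<forall>z\<in>U. \<forall>h. pullback (prolong f \<phi> \<psi>) (coframe fbar abar) z h = coframe f a z h)"

definition transition ::
    "(nat \<Rightarrow> jet \<Rightarrow> real) \<Rightarrow> (nat \<Rightarrow> jet \<Rightarrow> real) \<Rightarrow> (jet \<Rightarrow> jet) \<Rightarrow> jet \<Rightarrow> real^4^4" where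
  "transition a abar \<Phi> z = matrix_inv (cofmat (\<lambda>i. abar i (\<Phi> z))) ** cofmat (\<lambda>i. a i z)"

text \<open>The first conjunct says that the transition matrix has the shape that defines the b's.\<close>

definition determining_system ::
    "(jet \<Rightarrow> real) \<Rightarrow> jet set \<Rightarrow> (jet \<Rightarrow> real) \<Rightarrow> (nat \<Rightarrow> jet \<Rightarrow> real) \<Rightarrow> (nat \<Rightarrow> jet \<Rightarrow> real)
     \<Rightarrow> (plane \<Rightarrow> real) \<Rightarrow> (plane \<Rightarrow> real) \<Rightarrow> bool" where
  "determining_system f U fbar a abar \<phi> \<psi> \<longleftrightarrow>
     (\<forall>z\<in>U.
        let \<Phi> = prolong f \<phi> \<psi>; X = chi f \<phi> \<psi>; \<eta> = eta f \<phi> \<psi>;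
            B = transition a abar \<Phi> z; b = cofentry B; F = fbar (\<Phi> z)
        in B = cofmat b \<and>
           Dhat f \<eta> z = b 9 * F \<and> d_u \<eta> z = b 4 + b 7 * F \<and> d_p \<eta> z = b 5 \<and> d_q \<eta> z = b 6 \<and>
           Dhat f X z = b 9 * \<eta> z \<and> d_u X z = b 2 + b 7 * \<eta> z \<and> d_p X z = b 3 \<and>
           Dhat f (lift \<phi>) z = b 9 \<and> d_u (lift \<phi>) z = b 7 \<and>
           b 7 * Dhat f (lift \<psi>) z = b 9 * (d_u (lift \<psi>) z - b 1) \<and>
           F = Dhat f \<eta> z / Dhat f (lift \<phi>) z)"

end

theory Submission
  imports Defs
begin

text \<open>
  The vector fields \<open>Dhat\<close>, \<open>\<partial>/\<partial>u\<close>, \<open>\<partial>/\<partial>p\<close>, \<open>\<partial>/\<partial>q\<close> form the frame dual to the contact coframe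
  \<open>\<theta>\<^sub>1 = du - p dx\<close>, \<open>\<theta>\<^sub>2 = dp - q dx\<close>, \<open>\<theta>\<^sub>3 = dq - f dx\<close>, \<open>dx\<close>. Hence every differentiable function
  on the jet space satisfies \<open>dF = F\<^sub>u \<theta>\<^sub>1 + F\<^sub>p \<theta>\<^sub>2 + F\<^sub>q \<theta>\<^sub>3 + (Dhat F) dx\<close>
  (\<open>differential_in_contact_coframe\<close>). Cancelling the invertible matrix of the \<open>abar\<close>, equality of
  the coframes says that the contact coframe of the second jet space, pulled back, is \<open>b\<close> times the
  contact coframe of the first. Expanding \<open>d\<phi>\<close>, \<open>d\<psi>\<close>, \<open>d\<chi>\<close>, \<open>d\<eta>\<close> as above and comparing coefficients turns
  this into sixteen scalar equations. In the columns of \<open>\<theta>\<^sub>2\<close> and \<open>\<theta>\<^sub>3\<close> the zeros of the matrix agree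
  with the prolongation because \<open>\<phi>\<close> and \<open>\<psi>\<close> depend on neither p nor q and \<open>\<chi>\<close> does not depend on q. In
  the column of \<open>dx\<close> the zeros are the definitions of \<open>\<chi>\<close> and \<open>\<eta>\<close> and the formula
  \<open>fbar = Dhat \<eta> / Dhat \<phi>\<close>. What remains are the equations that determine the \<open>b\<close>. So
  matching of the coframes and the determining system are equivalent for every transformation that
  can be prolonged (\<open>coframes_match_iff_determining_system\<close>), which gives the first claim and half of
  the second.

  For the equivalence of the differential equations, let a curve \<open>u\<close> be mapped to the graph of \<open>v\<close>,
  that is \<open>v (\<phi> (t, u t)) = \<psi> (t, u t)\<close>. The derivative of \<open>\<phi> (t, u t)\<close> is \<open>Dhat \<phi> \<noteq> 0\<close>, so this is a
  change of the independent variable, and repeated differentiation shows that the 2-jet of \<open>v\<close> is the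
  prolongation of the 2-jet of \<open>u\<close>, while
  \<open>v''' = (Dhat \<eta> + (u''' - f) \<eta>\<^sub>q) / Dhat \<phi>\<close> (\<open>prolonged_curve\<close>). The system gives
  \<open>fbar = Dhat \<eta> / Dhat \<phi>\<close> at the prolonged jet and \<open>\<eta>\<^sub>q = b\<^sub>6 = a\<^sub>6 / abar\<^sub>6 \<noteq> 0\<close>. Therefore \<open>v''' = fbar\<close> if
  and only if \<open>u''' = f\<close>.
\<close>

section \<open>The contact coframe and its dual frame\<close>

lemma jet_function_along_curve:
  fixes F :: "jet \<Rightarrow> real" and c :: "real \<Rightarrow> jet"
  assumes "(F has_derivative F') (at (c t))" and "(c has_vector_derivative v) (at t)"
  shows "((\<lambda>s. F (c s)) has_real_derivative F' v) (at t)"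
  using vector_derivative_diff_chain_within[of c v t UNIV F F'] assms
  by (simp add: o_def has_derivative_at_withinI has_real_derivative_iff_has_vector_derivative)

lemma jet_partials:
  assumes "(F has_derivative F') (at z)"
  shows "d_x F z = F' (1,0,0,0)" and "d_u F z = F' (0,1,0,0)"
    and "d_p F z = F' (0,0,1,0)" and "d_q F z = F' (0,0,0,1)"
proof -
  obtain x u p q where z: "z = (x,u,p,q)" by (cases z)
  have along: "((\<lambda>s. F (c s)) has_real_derivative F' v) (at t)"
    if "c t = z" and "(c has_vector_derivative v) (at t)" for c t v
    using jet_function_along_curve[of F F' c t v] assms that by simp
  show "d_x F z = F' (1,0,0,0)"
    using along[of "\<lambda>t. (t,u,p,q)" x "(1,0,0,0)"]
    by (simp add: z d_x_def DERIV_imp_deriv has_vector_derivative_Pair)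
  show "d_u F z = F' (0,1,0,0)"
    using along[of "\<lambda>t. (x,t,p,q)" u "(0,1,0,0)"]
    by (simp add: z d_u_def DERIV_imp_deriv has_vector_derivative_Pair)
  show "d_p F z = F' (0,0,1,0)"
    using along[of "\<lambda>t. (x,u,t,q)" p "(0,0,1,0)"]
    by (simp add: z d_p_def DERIV_imp_deriv has_vector_derivative_Pair)
  show "d_q F z = F' (0,0,0,1)"
    using along[of "\<lambda>t. (x,u,p,t)" q "(0,0,0,1)"]
    by (simp add: z d_q_def DERIV_imp_deriv has_vector_derivative_Pair)
qed

lemma linear_on_jets:
  fixes L :: "jet \<Rightarrow> real"
  assumes "linear L"
  shows "L (a,b,c,d) = a * L (1,0,0,0) + b * L (0,1,0,0) + c * L (0,0,1,0) + d * L (0,0,0,1)"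
proof -
  have "(a,b,c,d) = a *\<^sub>R (1,0,0,0) + b *\<^sub>R (0,1,0,0) + c *\<^sub>R (0,0,1,0) + d *\<^sub>R ((0,0,0,1)::jet)"
    by simp
  then show ?thesis
    by (simp only: linear_add[OF assms] linear_scale[OF assms] real_scaleR_def)
qed

text \<open>
  A tangent vector with \<open>dx = k\<close> is expanded in the frame dual to the contact coframe. The parameter
  \<open>r\<close> takes the place of the third derivative: with \<open>r = f\<close> the numbers \<open>k1\<close>, \<open>k2\<close>, \<open>k3\<close> are the contact
  components and the correction term vanishes; with \<open>r = u'''\<close> and \<open>k = 1\<close> the vector is tangent to the
  2-jet of a curve that need not be a solution.
\<close>

lemma differential_in_contact_coframe:
  assumes "(F has_derivative F') (at (x,u,p,q))"
  shows "F' (k, k1 + p * k, k2 + q * k, k3 + r * k)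
    = k1 * d_u F (x,u,p,q) + k2 * d_p F (x,u,p,q)
      + k3 * d_q F (x,u,p,q) + k * (Dhat f F (x,u,p,q) + (r - f (x,u,p,q)) * d_q F (x,u,p,q))"
proof -
  have "linear F'" using assms has_derivative_linear by blast
  then show ?thesis
    by (subst linear_on_jets) (simp_all add: Dhat_def jet_partials[OF assms] algebra_simps)
qed

section \<open>Total derivatives of functions of x, u, p\<close>

text \<open>
  That the derivative along \<open>(1, p, q, r)\<close> is the same for all \<open>r\<close> means that \<open>F\<close> does not depend on q to
  first order, so that its total derivative makes sense without an equation \<open>f\<close>. The condition
  is pointwise and closed under the arithmetic operations.
\<close>

definition has_total_derivative :: "(jet \<Rightarrow> real) \<Rightarrow> real \<Rightarrow> jet \<Rightarrow> bool" where
  "has_total_derivative F D = (\<lambda>(x,u,p,q).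
     \<exists>F'. (F has_derivative F') (at (x,u,p,q)) \<and> (\<forall>r. F' (1,p,q,r) = D))"

lemma has_total_derivative_imp:
  assumes "has_total_derivative F D z"
  shows "F differentiable (at z)" and "Dhat f F z = D" and "d_q F z = 0"
proof -
  obtain x u p q where z: "z = (x,u,p,q)" by (cases z)
  obtain F' where F: "(F has_derivative F') (at (x,u,p,q))" and D: "\<And>r. F' (1,p,q,r) = D"
    using assms unfolding has_total_derivative_def z by auto
  show "F differentiable (at z)" using F z differentiable_def by blast
  have *: "F' (1,p,q,r) = Dhat f F z + (r - f z) * d_q F z" for r
    using differential_in_contact_coframe[OF F, of 1 0 0 0 r f] by (simp add: z)
  show "Dhat f F z = D" using *[of "f z"] D by simp
  show "d_q F z = 0" using *[of "f z"] *[of "f z + 1"] D by simp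
qed

lemma has_total_derivativeE:
  assumes "has_total_derivative F D z"
  obtains F' where "(F has_derivative F') (at z)"
    and "\<And>r. F' (1, fst (snd (snd z)), snd (snd (snd z)), r) = D"
  using assms unfolding has_total_derivative_def by (auto split: prod.splits)

lemma has_total_derivativeI:
  assumes "(F has_derivative F') (at z)"
    and "\<And>r. F' (1, fst (snd (snd z)), snd (snd (snd z)), r) = D"
  shows "has_total_derivative F D z"
  using assms unfolding has_total_derivative_def by (auto split: prod.splits)

lemma has_total_derivative_add:
  assumes "has_total_derivative F D z" and "has_total_derivative G E z"
  shows "has_total_derivative (\<lambda>z. F z + G z) (D + E) z"
  using assms by (elim has_total_derivativeE)
    (rule has_total_derivativeI, rule has_derivative_add, assumption, assumption, simp)

lemma has_total_derivative_mult:
  assumes "has_total_derivative F D z" and "has_total_derivative G E z"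
  shows "has_total_derivative (\<lambda>z. F z * G z) (F z * E + D * G z) z"
  using assms by (elim has_total_derivativeE)
    (rule has_total_derivativeI, rule has_derivative_mult, assumption, assumption, simp)

lemma has_total_derivative_divide:
  assumes "has_total_derivative F D z" and "has_total_derivative G E z" and "G z \<noteq> 0"
  shows "has_total_derivative (\<lambda>z. F z / G z) ((D * G z - F z * E) / (G z * G z)) z"
  using assms by (elim has_total_derivativeE)
    (rule has_total_derivativeI, rule has_derivative_divide', assumption, assumption, simp_all)

lemma has_total_derivative_p:
  "has_total_derivative (\<lambda>(x,u,p,q). p) q (x,u,p,q)"
  unfolding has_total_derivative_def prod.case case_prod_beta
  by (rule exI[of _ "\<lambda>h. fst (snd (snd h))"]) (auto intro!: derivative_eq_intros)

lemma has_total_derivative_cong: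
  assumes "has_total_derivative F D z" and "open S" "z \<in> S" "\<And>y. y \<in> S \<Longrightarrow> F y = G y"
  shows "has_total_derivative G D z"
  using assms by (elim has_total_derivativeE)
    (rule has_total_derivativeI, erule has_derivative_transform_within_open[of F _ z UNIV S], simp_all)

section \<open>Total derivatives of functions of x, u\<close>

definition partial :: "plane \<Rightarrow> (plane \<Rightarrow> real) \<Rightarrow> plane \<Rightarrow> real" where
  "partial v g y = frechet_derivative g (at y) v"

text \<open>
  The formula \<open>g\<^sub>x + p g\<^sub>u\<close>, with derivatives only in the base variables. In contrast to \<open>Dhat f\<close> it does
  not contain the arbitrary function \<open>f\<close>, so its differentiability can be read off.
\<close>

definition total_derivative :: "(plane \<Rightarrow> real) \<Rightarrow> jet \<Rightarrow> real" where
  "total_derivative g = (\<lambda>z. lift (partial (1,0) g) z + (\<lambda>(x,u,p,q). p) z * lift (partial (0,1) g) z)"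

text \<open>
  The total derivative of \<open>g\<^sub>x + p g\<^sub>u\<close>, again with derivatives only in the base variables.
\<close>

definition second_total_derivative :: "(plane \<Rightarrow> real) \<Rightarrow> jet \<Rightarrow> real" where
  "second_total_derivative g = (\<lambda>z. total_derivative (partial (1,0) g) z
      + ((\<lambda>(x,u,p,q). p) z * total_derivative (partial (0,1) g) z
      + (\<lambda>(x,u,p,q). q) z * lift (partial (0,1) g) z))"

lemma smooth_on_partial: "smooth_on W g \<Longrightarrow> smooth_on W (partial v g)"
  unfolding smooth_on_def partial_def [abs_def] by (metis C_k_on.simps(2))

lemma smooth_on_has_derivative:
  assumes "smooth_on W g" "open W" "y \<in> W"
  shows "(g has_derivative (\<lambda>v. partial v g y)) (at y)"
proof -
  have "g differentiable_on W" using assms(1) unfolding smooth_on_def by (metis C_k_on.simps(2))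
  then have "g differentiable (at y)"
    using assms differentiable_on_eq_differentiable_at by blast
  then show ?thesis by (simp only: partial_def frechet_derivative_works[symmetric])
qed

lemma has_derivative_lift:
  assumes "smooth_on W g" "open W" "base z \<in> W"
  shows "(lift g has_derivative (\<lambda>h. partial (base h) g (base z))) (at z)"
proof -
  have "(base has_derivative base) (at z)"
    unfolding base_def case_prod_beta by (auto intro!: derivative_eq_intros)
  from has_derivative_compose[OF this smooth_on_has_derivative[OF assms]]
  show ?thesis by (simp add: lift_def [abs_def])
qed

lemma has_total_derivative_lift:
  assumes "smooth_on W g" "open W" "base z \<in> W"
  shows "has_total_derivative (lift g) (total_derivative g z) z"
proof -
  obtain x u p q where z: "z = (x,u,p,q)" by (cases z)
  have "linear (\<lambda>v. partial v g (x,u))"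
    using smooth_on_has_derivative[OF assms] has_derivative_linear by (auto simp: z base_def)
  from linear_add[OF this, of "(1,0)" "p *\<^sub>R (0,1)"] linear_scale[OF this, of p "(0,1)"]
  have "partial (1,p) g (x,u) = total_derivative g z"
    by (simp add: z total_derivative_def lift_def base_def)
  then show ?thesis
    by (intro has_total_derivativeI[OF has_derivative_lift[OF assms]]) (simp add: z base_def)
qed

lemma d_p_lift:
  assumes "smooth_on W g" "open W" "base z \<in> W"
  shows "d_p (lift g) z = 0"
  using linear_0[OF has_derivative_linear[OF smooth_on_has_derivative[OF assms]]]
  by (subst jet_partials[OF has_derivative_lift[OF assms]]) (simp add: base_def zero_prod_def)

lemma has_total_derivative_total_derivative:
  assumes "smooth_on W g" "open W" "base z \<in> W"
  shows "has_total_derivative (total_derivative g) (second_total_derivative g z) z"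
proof -
  obtain x u p q where z: "z = (x,u,p,q)" by (cases z)
  show ?thesis
    using has_total_derivative_add[OF has_total_derivative_lift
        has_total_derivative_mult[OF has_total_derivative_p has_total_derivative_lift],
      OF smooth_on_partial[OF assms(1)] assms(2) _ smooth_on_partial[OF assms(1)] assms(2),
      of x u p q "(1,0)" "(0,1)"] assms(3)
    unfolding total_derivative_def[of g] second_total_derivative_def by (simp add: z)
qed

lemma differentiable_second_total_derivative:
  assumes "smooth_on W g" "open W" "base z \<in> W"
  shows "second_total_derivative g differentiable (at z)"
proof -
  note s = smooth_on_partial[OF assms(1)]
  have "(\<lambda>(x,u,p,q). p) differentiable (at (z::jet))" "(\<lambda>(x,u,p,q). q) differentiable (at (z::jet))"
    unfolding case_prod_beta differentiable_def by (auto intro!: derivative_eq_intros exI)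
  then show ?thesis
    unfolding second_total_derivative_def
    by (intro differentiable_add differentiable_mult
        has_total_derivative_imp(1)[OF has_total_derivative_lift[OF s]]
        has_total_derivative_imp(1)[OF has_total_derivative_total_derivative[OF s]] assms(2,3))
qed

section \<open>Differentiation along curves\<close>

lemma nonzero_derivative_image:
  fixes g :: "real \<Rightarrow> real"
  assumes "open I" and "is_interval I"
    and der: "\<And>t. t \<in> I \<Longrightarrow> (g has_real_derivative g' t) (at t)"
    and nz: "\<And>t. t \<in> I \<Longrightarrow> g' t \<noteq> 0"
  shows "inj_on g I" and "open (g ` I)" and "is_interval (g ` I)"
proof -
  have cont: "continuous_on I g"
    using der by (meson DERIV_isCont continuous_at_imp_continuous_on)
  show inj: "inj_on g I"
  proof (rule linorder_inj_onI')
    fix s t assume st: "s \<in> I" "t \<in> I" "s < t"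
    then have sub: "r \<in> I" if "s \<le> r" "r \<le> t" for r
      using assms(2) that unfolding is_interval_1 by blast
    obtain r where "s < r" "r < t" "g t - g s = (t - s) * g' r"
      using MVT2[OF st(3), of g g'] der sub by blast
    then show "g s \<noteq> g t" using nz[of r] sub[of r] by auto
  qed
  show "open (g ` I)"
    using injective_eq_1d_open_map_UNIV[OF cont assms(2)] inj assms(1) by blast
  show "is_interval (g ` I)"
    using connected_continuous_image[OF cont] assms(2) is_interval_connected_1 by blast
qed

text \<open>
  The function \<open>v\<close> is known only through \<open>v \<circ> g = w\<close>; since \<open>g\<close> has a differentiable inverse on the
  open set \<open>g ` I\<close>, that already forces \<open>v\<close> to be differentiable. So the image of a curve is
  differentiable, and the derivatives of any \<open>v\<close> with that graph can be computed, by the same rule.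
\<close>

lemma derivative_after_reparametrization:
  fixes g w v :: "real \<Rightarrow> real"
  assumes "open I" and "is_interval I"
    and der: "\<And>t. t \<in> I \<Longrightarrow> (g has_real_derivative g' t) (at t)"
    and nz: "\<And>t. t \<in> I \<Longrightarrow> g' t \<noteq> 0"
    and vg: "\<And>s. s \<in> I \<Longrightarrow> v (g s) = w s"
    and t: "t \<in> I" and w: "(w has_real_derivative w') (at t)"
  shows "(v has_real_derivative w' / g' t) (at (g t))"
proof -
  note img = nonzero_derivative_image[OF assms(1,2) der nz]
  define h where "h = the_inv_into I g"
  have hg: "h (g s) = s" if "s \<in> I" for s
    unfolding h_def using the_inv_into_f_f[OF img(1)] that by blast
  have "(h has_derivative (\<lambda>x. 1 / g' t * x)) (at (g t))"
  proof (rule has_derivative_inverse_strong[where S = I and f = g])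
    show "open I" "t \<in> I" "\<And>s. s \<in> I \<Longrightarrow> h (g s) = s" using assms(1) t hg by auto
    show "continuous_on I g"
      using der by (meson DERIV_isCont continuous_at_imp_continuous_on)
    show "(g has_derivative (\<lambda>x. g' t * x)) (at t)"
      using der[OF t] by (simp add: has_field_derivative_def)
    show "(\<lambda>x. g' t * x) \<circ> (\<lambda>x. 1 / g' t * x) = id"
      using nz[OF t] by (simp add: fun_eq_iff)
  qed
  then have "(h has_real_derivative 1 / g' t) (at (g t))"
    unfolding has_field_derivative_def .
  moreover have "(w has_real_derivative w') (at (h (g t)))"
    using w hg[OF t] by simp
  ultimately have "((\<lambda>y. w (h y)) has_real_derivative w' * (1 / g' t)) (at (g t))"
    by (rule DERIV_chain2[rotated])
  then have "(v has_real_derivative w' * (1 / g' t)) (at (g t))"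
    by (rule has_field_derivative_transform_within_open[OF _ img(2)])
       (use t hg vg in auto)
  then show ?thesis by simp
qed

lemma jet2_has_vector_derivative:
  assumes "curve_in U I u" and "t \<in> I"
  shows "(jet2 u has_vector_derivative
    (1, deriv u t, deriv (deriv u) t, deriv (deriv (deriv u)) t)) (at t)"
proof -
  have "(w has_vector_derivative deriv w t) (at t)" if "w differentiable (at t)" for w :: "real \<Rightarrow> real"
    using that DERIV_deriv_iff_real_differentiable has_real_derivative_iff_has_vector_derivative by blast
  then show ?thesis
    using assms unfolding jet2_def [abs_def] curve_in_def
    by (auto intro!: has_vector_derivative_Pair)
qed

lemma derivative_along_jet2:
  assumes "curve_in U I u" and "t \<in> I" and F: "F differentiable (at (jet2 u t))"
  shows "((\<lambda>s. F (jet2 u s)) has_real_derivative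
    Dhat f F (jet2 u t) + (deriv (deriv (deriv u)) t - f (jet2 u t)) * d_q F (jet2 u t)) (at t)"
proof -
  obtain F' where F': "(F has_derivative F') (at (jet2 u t))"
    using F differentiable_def by blast
  show ?thesis
    using jet_function_along_curve[OF F' jet2_has_vector_derivative[OF assms(1,2)]]
      differential_in_contact_coframe[OF F'[unfolded jet2_def], of 1 0 0 0 _ f]
    by (simp add: jet2_def)
qed

lemma total_derivative_along_jet2:
  assumes "curve_in U I u" and F: "has_total_derivative F D (jet2 u t)" and "t \<in> I"
  shows "((\<lambda>s. F (jet2 u s)) has_real_derivative Dhat f F (jet2 u t)) (at t)"
  using derivative_along_jet2[OF assms(1,3) has_total_derivative_imp(1)[OF F], of f]
    has_total_derivative_imp(3)[OF F] by simp

section \<open>The second prolongation\<close>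

locale prolongable =
  fixes f :: "jet \<Rightarrow> real" and U Ubar :: "jet set" and W :: "plane set" and \<phi> \<psi> :: "plane \<Rightarrow> real"
  assumes open_U: "open U" and open_W: "open W" and base_U: "base ` U \<subseteq> W"
    and smooth: "smooth_on W \<phi>" "smooth_on W \<psi>"
    and into: "prolongs_into f \<phi> \<psi> U Ubar"
begin

lemma nonzero: "z \<in> U \<Longrightarrow> Dhat f (lift \<phi>) z \<noteq> 0"
  and prolong_in_Ubar: "z \<in> U \<Longrightarrow> prolong f \<phi> \<psi> z \<in> Ubar"
  using into unfolding prolongs_into_def by blast+

lemma base_in_W: "z \<in> U \<Longrightarrow> base z \<in> W"
  using base_U by blast

lemma Dhat_lift:
  assumes "smooth_on W g" "z \<in> U"
  shows "Dhat f (lift g) z = total_derivative g z"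
  using has_total_derivative_imp(2)[OF has_total_derivative_lift[OF assms(1) open_W]]
    base_in_W[OF assms(2)] by blast

lemma total_nonzero: "z \<in> U \<Longrightarrow> total_derivative \<phi> z \<noteq> 0"
  using nonzero Dhat_lift[OF smooth(1)] by simp

text \<open>
  On the open set \<open>U\<close> the function \<open>chi\<close> is the quotient of two explicit total derivatives, so the
  quotient rule applies and shows at the same time that \<open>chi\<close> does not depend on q.
\<close>

lemma has_total_derivative_chi:
  assumes "z \<in> U"
  shows "has_total_derivative (chi f \<phi> \<psi>)
    ((second_total_derivative \<psi> z * total_derivative \<phi> z
      - total_derivative \<psi> z * second_total_derivative \<phi> z)
      / (total_derivative \<phi> z * total_derivative \<phi> z)) z"
proof (rule has_total_derivative_cong[OF has_total_derivative_divide open_U assms])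
  show "has_total_derivative (total_derivative \<psi>) (second_total_derivative \<psi> z) z"
    "has_total_derivative (total_derivative \<phi>) (second_total_derivative \<phi> z) z"
    using has_total_derivative_total_derivative smooth open_W base_in_W[OF assms] by blast+
  show "total_derivative \<phi> z \<noteq> 0" using total_nonzero[OF assms] .
  show "total_derivative \<psi> y / total_derivative \<phi> y = chi f \<phi> \<psi> y" if "y \<in> U" for y
    using that by (simp add: chi_def Dhat_lift smooth)
qed

text \<open>
  By the formula for the total derivative of \<open>chi\<close>, the function \<open>eta\<close> is rational in first and second
  total derivatives of \<open>\<phi>\<close> and \<open>\<psi>\<close>: the \<open>f\<close> in its definition is multiplied by the derivative of
  \<open>chi\<close> with respect to q, which is zero.
\<close>

lemma differentiable_eta:
  assumes z: "z \<in> U"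
  shows "eta f \<phi> \<psi> differentiable (at z)"
proof -
  let ?e = "\<lambda>z. (second_total_derivative \<psi> z * total_derivative \<phi> z
      - total_derivative \<psi> z * second_total_derivative \<phi> z)
      / (total_derivative \<phi> z * total_derivative \<phi> z) / total_derivative \<phi> z"
  have "total_derivative g differentiable (at z)" "second_total_derivative g differentiable (at z)"
    if "smooth_on W g" for g
    using has_total_derivative_imp(1)[OF has_total_derivative_total_derivative[OF that open_W]]
      differentiable_second_total_derivative[OF that open_W] base_in_W[OF z] by blast+
  then have "?e differentiable (at z)"
    using smooth total_nonzero[OF z] by simp
  moreover have "?e y = eta f \<phi> \<psi> y" if "y \<in> U" for y
    using that has_total_derivative_imp(2)[OF has_total_derivative_chi[OF that]]
    by (simp add: eta_def Dhat_lift smooth)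
  ultimately show ?thesis
    unfolding differentiable_def
    using has_derivative_transform_within_open[OF _ open_U z] by blast
qed

lemma prolong_differentials:
  assumes "z \<in> U"
  shows "(lift \<phi> has_derivative frechet_derivative (lift \<phi>) (at z)) (at z)"
    and "(lift \<psi> has_derivative frechet_derivative (lift \<psi>) (at z)) (at z)"
    and "(chi f \<phi> \<psi> has_derivative frechet_derivative (chi f \<phi> \<psi>) (at z)) (at z)"
    and "(eta f \<phi> \<psi> has_derivative frechet_derivative (eta f \<phi> \<psi>) (at z)) (at z)"
  using has_total_derivative_imp(1)[OF has_total_derivative_lift[OF _ open_W base_in_W[OF assms]]] smooth
    has_total_derivative_imp(1)[OF has_total_derivative_chi[OF assms]] differentiable_eta[OF assms]
  by (simp_all only: frechet_derivative_works[symmetric])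

lemma frechet_derivative_prolong:
  assumes "z \<in> U"
  shows "frechet_derivative (prolong f \<phi> \<psi>) (at z) h
    = (frechet_derivative (lift \<phi>) (at z) h, frechet_derivative (lift \<psi>) (at z) h,
       frechet_derivative (chi f \<phi> \<psi>) (at z) h, frechet_derivative (eta f \<phi> \<psi>) (at z) h)"
proof -
  have "(prolong f \<phi> \<psi> has_derivative (\<lambda>h.
      (frechet_derivative (lift \<phi>) (at z) h, frechet_derivative (lift \<psi>) (at z) h,
       frechet_derivative (chi f \<phi> \<psi>) (at z) h, frechet_derivative (eta f \<phi> \<psi>) (at z) h))) (at z)"
    unfolding prolong_def
    by (intro has_derivative_Pair prolong_differentials[OF assms])
  from fun_cong[OF frechet_derivative_at[OF this], of h] show ?thesis by (rule sym)
qed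


lemma along_lift:
  assumes "curve_in U I u" and "smooth_on W k" and t: "t \<in> I"
  shows "((\<lambda>s. k (s, u s)) has_real_derivative Dhat f (lift k) (jet2 u t)) (at t)"
proof -
  have "base (jet2 u t) \<in> W"
    using assms(1) t by (auto simp: curve_in_def intro: base_in_W)
  from total_derivative_along_jet2[OF assms(1) has_total_derivative_lift[OF assms(2) open_W this] t]
  show ?thesis by (simp add: lift_def base_def jet2_def)
qed

text \<open>
  Starting from \<open>v \<circ> g = \<psi>\<close> along the curve, each differentiation divides by \<open>g' = Dhat \<phi>\<close> and produces
  the next component of the prolongation. Only the last step sees \<open>u'''\<close>, because \<open>eta\<close> is the first
  function in the chain that depends on q.
\<close>

lemma prolonged_curve:
  assumes u: "curve_in U I u" and v: "\<And>t. t \<in> I \<Longrightarrow> v (\<phi> (t, u t)) = \<psi> (t, u t)"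
  defines "g \<equiv> \<lambda>t. \<phi> (t, u t)"
  shows "curve_in Ubar (g ` I) v"
    and "t \<in> I \<Longrightarrow> jet2 v (g t) = prolong f \<phi> \<psi> (jet2 u t)"
    and "t \<in> I \<Longrightarrow> deriv (deriv (deriv v)) (g t)
      = (Dhat f (eta f \<phi> \<psi>) (jet2 u t)
         + (deriv (deriv (deriv u)) t - f (jet2 u t)) * d_q (eta f \<phi> \<psi>) (jet2 u t))
        / Dhat f (lift \<phi>) (jet2 u t)"
proof -
  have I: "open I" "is_interval I" and U: "\<And>t. t \<in> I \<Longrightarrow> jet2 u t \<in> U"
    using u by (auto simp: curve_in_def)
  define g' where "g' t = Dhat f (lift \<phi>) (jet2 u t)" for t
  note along = total_derivative_along_jet2[OF u, where f = f]
  have g: "(g has_real_derivative g' t) (at t)" "g' t \<noteq> 0" if "t \<in> I" for t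
    using along_lift[OF u smooth(1) that] nonzero[OF U[OF that]] by (simp_all add: g_def g'_def)
  note reparam = derivative_after_reparametrization[OF I g]
  have 1: "(v has_real_derivative chi f \<phi> \<psi> (jet2 u t)) (at (g t))" if "t \<in> I" for t
    using reparam[where v = v, OF _ _ _ that along_lift[OF u smooth(2) that]] v
    by (simp add: g_def chi_def g'_def)
  have 2: "(deriv v has_real_derivative eta f \<phi> \<psi> (jet2 u t)) (at (g t))" if "t \<in> I" for t
    using reparam[where v = "deriv v", OF _ _ _ that along[OF has_total_derivative_chi[OF U[OF that]] that]]
      DERIV_imp_deriv[OF 1] by (simp add: eta_def g'_def)
  have 3: "(deriv (deriv v) has_real_derivative (Dhat f (eta f \<phi> \<psi>) (jet2 u t)
         + (deriv (deriv (deriv u)) t - f (jet2 u t)) * d_q (eta f \<phi> \<psi>) (jet2 u t))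
        / Dhat f (lift \<phi>) (jet2 u t)) (at (g t))" if "t \<in> I" for t
    using reparam[where v = "deriv (deriv v)",
        OF _ _ _ that derivative_along_jet2[OF u that differentiable_eta[OF U[OF that]]]]
      DERIV_imp_deriv[OF 2] by (simp add: g'_def)
  show jet: "jet2 v (g t) = prolong f \<phi> \<psi> (jet2 u t)" if "t \<in> I" for t
    using DERIV_imp_deriv[OF 1[OF that]] DERIV_imp_deriv[OF 2[OF that]] v[OF that]
    by (simp add: jet2_def prolong_def lift_def base_def g_def)
  show "deriv (deriv (deriv v)) (g t) = (Dhat f (eta f \<phi> \<psi>) (jet2 u t)
         + (deriv (deriv (deriv u)) t - f (jet2 u t)) * d_q (eta f \<phi> \<psi>) (jet2 u t))
        / Dhat f (lift \<phi>) (jet2 u t)" if "t \<in> I" for t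
    using DERIV_imp_deriv[OF 3[OF that]] .
  have "open (g ` I)" "is_interval (g ` I)"
    using nonzero_derivative_image[OF I g] by blast+
  then show "curve_in Ubar (g ` I) v"
    using 1 2 3 jet prolong_in_Ubar U unfolding curve_in_def
    by (auto simp: real_differentiable_def)
qed

lemma image_is_graph:
  assumes u: "curve_in U I u"
  obtains v where "\<And>t. t \<in> I \<Longrightarrow> v (\<phi> (t, u t)) = \<psi> (t, u t)"
proof -
  let ?g = "\<lambda>t. \<phi> (t, u t)"
  have I: "open I" "is_interval I" and U: "\<And>t. t \<in> I \<Longrightarrow> jet2 u t \<in> U"
    using u by (auto simp: curve_in_def)
  have "inj_on ?g I"
    using nonzero_derivative_image(1)[OF I along_lift[OF u smooth(1)] nonzero[OF U]] .
  then show thesis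
    using that[of "\<lambda>y. \<psi> (the_inv_into I ?g y, u (the_inv_into I ?g y))"]
    by (simp add: the_inv_into_f_f[of ?g])
qed

text \<open>
  The deviations from the two equations are proportional:
  \<open>v''' - fbar = (u''' - f) \<eta>\<^sub>q / Dhat \<phi>\<close>.
\<close>

lemma ode_equivalent_if_third_derivative:
  assumes fbar: "\<And>z. z \<in> U \<Longrightarrow> fbar (prolong f \<phi> \<psi> z) = Dhat f (eta f \<phi> \<psi>) z / Dhat f (lift \<phi>) z"
    and eta_q: "\<And>z. z \<in> U \<Longrightarrow> d_q (eta f \<phi> \<psi>) z \<noteq> 0"
  shows "ode_equivalent f U fbar Ubar \<phi> \<psi>"
proof -
  have key: "ode_solution fbar Ubar ((\<lambda>t. \<phi> (t, u t)) ` I) v \<longleftrightarrow> ode_solution f U I u"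
    if u: "curve_in U I u" and v: "\<And>t. t \<in> I \<Longrightarrow> v (\<phi> (t, u t)) = \<psi> (t, u t)" for I u v
  proof -
    have "deriv (deriv (deriv v)) (\<phi> (t, u t)) = fbar (jet2 v (\<phi> (t, u t)))
        \<longleftrightarrow> deriv (deriv (deriv u)) t = f (jet2 u t)" if t: "t \<in> I" for t
    proof -
      have U: "jet2 u t \<in> U" using u t by (simp add: curve_in_def)
      have "jet2 v (\<phi> (t, u t)) = prolong f \<phi> \<psi> (jet2 u t)"
        using prolonged_curve(2)[OF u v t] by simp
      moreover note prolonged_curve(3)[OF u v t]
      ultimately show ?thesis
        using fbar[OF U] nonzero[OF U] eta_q[OF U] by (simp add: add_divide_distrib)
    qed
    then show ?thesis
      using prolonged_curve(1)[OF u v] u by (auto simp: ode_solution_def)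
  qed
  show ?thesis
    unfolding ode_equivalent_def
  proof (intro allI impI)
    fix I u assume u: "curve_in U I u"
    obtain v where v: "\<And>t. t \<in> I \<Longrightarrow> v (\<phi> (t, u t)) = \<psi> (t, u t)"
      using image_is_graph[OF u] by blast
    show "ode_solution f U I u \<longleftrightarrow> (\<exists>v. (\<forall>t\<in>I. v (\<phi> (t, u t)) = \<psi> (t, u t)) \<and>
        ode_solution fbar Ubar ((\<lambda>t. \<phi> (t, u t)) ` I) v)"
      using key[OF u] v by blast
  qed
qed

end

section \<open>The group of coefficient matrices\<close>

lemma vector_4:
  "(vector [a,b,c,d] :: 'a::zero^4) $ 1 = a" "(vector [a,b,c,d] :: 'a::zero^4) $ 2 = b"
  "(vector [a,b,c,d] :: 'a::zero^4) $ 3 = c" "(vector [a,b,c,d] :: 'a::zero^4) $ 4 = d"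
  unfolding vector_def by simp_all

lemma cofmat_mult_vector:
  "cofmat c *v k = vector [c 1 * k$1, c 2 * k$1 + c 3 * k$2,
     c 4 * k$1 + c 5 * k$2 + c 6 * k$3, c 7 * k$1 + c 9 * k$4]"
  by (simp add: vec_eq_iff forall_4 sum_4 matrix_vector_mult_def cofmat_def vector_4)

lemma cofentry_cofmat:
  "cofmat (cofentry (cofmat c)) = cofmat c"
  by (simp add: vec_eq_iff forall_4 cofmat_def cofentry_def vector_4)

lemma cofmat_mult:
  obtains e where "cofmat c ** cofmat d = cofmat e"
proof
  show "cofmat c ** cofmat d = cofmat (cofentry (cofmat c ** cofmat d))"
    by (simp add: vec_eq_iff forall_4 sum_4 matrix_matrix_mult_def cofmat_def cofentry_def vector_4)
qed

lemma cofmat_inverse: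
  assumes "c 1 * c 3 * c 6 * c 9 \<noteq> 0"
  obtains d where "matrix_inv (cofmat c) = cofmat d" and "cofmat c ** cofmat d = mat 1"
proof -
  define D :: "real^4^4" where "D =
    vector [vector [1 / c 1, 0, 0, 0],
            vector [- c 2 / (c 1 * c 3), 1 / c 3, 0, 0],
            vector [(c 2 * c 5 - c 3 * c 4) / (c 1 * c 3 * c 6), - c 5 / (c 3 * c 6), 1 / c 6, 0],
            vector [- c 7 / (c 1 * c 9), 0, 0, 1 / c 9]]"
  have D: "D = cofmat (cofentry D)"
    by (simp add: D_def vec_eq_iff forall_4 cofmat_def cofentry_def vector_4)
  have right: "cofmat c ** D = mat 1"
    using assms
    by (simp add: D_def vec_eq_iff forall_4 sum_4 matrix_matrix_mult_def cofmat_def vector_4 mat_def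
        field_simps)
  then have left: "D ** cofmat c = mat 1"
    using matrix_left_right_inverse by blast
  then have "matrix_inv (cofmat c) ** cofmat c = mat 1"
    unfolding matrix_inv_def using right by (metis (mono_tags, lifting) someI_ex)
  then have "matrix_inv (cofmat c) = D"
    using right by (metis matrix_mul_assoc matrix_mul_lid matrix_mul_rid)
  then show thesis using that[of "cofentry D"] D right by simp
qed

text \<open>
  Invertible matrices of the shape \<open>cofmat\<close> have an inverse of that shape, and products keep it. This
  is why the transition matrix can be described by the coefficients \<open>b\<close>.
\<close>

lemma transition_eq:
  assumes "abar 1 (\<Phi> z) * abar 3 (\<Phi> z) * abar 6 (\<Phi> z) * abar 9 (\<Phi> z) \<noteq> 0"
  shows "cofmat (\<lambda>i. abar i (\<Phi> z)) ** transition a abar \<Phi> z = cofmat (\<lambda>i. a i z)"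
    and "transition a abar \<Phi> z = cofmat (cofentry (transition a abar \<Phi> z))"
proof -
  obtain d where d: "matrix_inv (cofmat (\<lambda>i. abar i (\<Phi> z))) = cofmat d"
    and inv: "cofmat (\<lambda>i. abar i (\<Phi> z)) ** cofmat d = mat 1"
    using cofmat_inverse[of "\<lambda>i. abar i (\<Phi> z)"] assms by auto
  show "cofmat (\<lambda>i. abar i (\<Phi> z)) ** transition a abar \<Phi> z = cofmat (\<lambda>i. a i z)"
    unfolding transition_def d by (simp add: matrix_mul_assoc inv)
  show "transition a abar \<Phi> z = cofmat (cofentry (transition a abar \<Phi> z))"
    unfolding transition_def d by (metis cofmat_mult cofentry_cofmat)
qed

lemma cofmat_mult_6:
  "(cofmat c ** cofmat b) $ 3 $ 3 = c 6 * b 6"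
  by (simp add: sum_4 matrix_matrix_mult_def cofmat_def vector_4)

section \<open>Matching coframes and the determining system\<close>

text \<open>
  The scalar equations at one point, for arbitrary coefficients \<open>b\<close>, separated from the requirement
  that \<open>b\<close> comes from the transition matrix.
\<close>

definition transformation_equations ::
    "(jet \<Rightarrow> real) \<Rightarrow> (jet \<Rightarrow> real) \<Rightarrow> (nat \<Rightarrow> real)
     \<Rightarrow> (plane \<Rightarrow> real) \<Rightarrow> (plane \<Rightarrow> real) \<Rightarrow> jet \<Rightarrow> bool" where
  "transformation_equations f fbar b \<phi> \<psi> z \<longleftrightarrow>
    (let X = chi f \<phi> \<psi>; \<eta> = eta f \<phi> \<psi>; F = fbar (prolong f \<phi> \<psi> z)
     in Dhat f \<eta> z = b 9 * F \<and> d_u \<eta> z = b 4 + b 7 * F \<and> d_p \<eta> z = b 5 \<and> d_q \<eta> z = b 6 \<and>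
        Dhat f X z = b 9 * \<eta> z \<and> d_u X z = b 2 + b 7 * \<eta> z \<and> d_p X z = b 3 \<and>
        Dhat f (lift \<phi>) z = b 9 \<and> d_u (lift \<phi>) z = b 7 \<and>
        b 7 * Dhat f (lift \<psi>) z = b 9 * (d_u (lift \<psi>) z - b 1) \<and>
        F = Dhat f \<eta> z / Dhat f (lift \<phi>) z)"

lemma determining_system_iff:
  "determining_system f U fbar a abar \<phi> \<psi> \<longleftrightarrow>
    (\<forall>z\<in>U. let B = transition a abar (prolong f \<phi> \<psi>) z
       in B = cofmat (cofentry B) \<and> transformation_equations f fbar (cofentry B) \<phi> \<psi> z)"
  unfolding determining_system_def transformation_equations_def Let_def ..

context prolongable
begin

text \<open>
  The invertible matrix of the \<open>abar\<close> cancels, because the right-hand side is this matrix applied to the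
  transition matrix times the contact coframe.
\<close>

lemma coframe_match_iff_transition:
  assumes "z \<in> U"
    and "abar 1 (prolong f \<phi> \<psi> z) * abar 3 (prolong f \<phi> \<psi> z) * abar 6 (prolong f \<phi> \<psi> z)
      * abar 9 (prolong f \<phi> \<psi> z) \<noteq> 0"
  shows "pullback (prolong f \<phi> \<psi>) (coframe fbar abar) z h = coframe f a z h \<longleftrightarrow>
    contact_coframe fbar (prolong f \<phi> \<psi> z) (frechet_derivative (prolong f \<phi> \<psi>) (at z) h)
     = transition a abar (prolong f \<phi> \<psi>) z *v contact_coframe f z h"
proof -
  let ?A = "cofmat (\<lambda>i. abar i (prolong f \<phi> \<psi> z))"
  obtain d where d: "?A ** cofmat d = mat 1"
    using cofmat_inverse[of "\<lambda>i. abar i (prolong f \<phi> \<psi> z)"] assms by auto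
  then have "cofmat d ** ?A = mat 1"
    using matrix_left_right_inverse by blast
  then have "cofmat d *v (?A *v k) = k" for k
    by (simp add: matrix_vector_mul_assoc)
  then have inj: "?A *v k = ?A *v l \<longleftrightarrow> k = l" for k l
    by metis
  have "coframe f a z h = ?A *v (transition a abar (prolong f \<phi> \<psi>) z *v contact_coframe f z h)"
    using transition_eq(1)[of abar "prolong f \<phi> \<psi>" z a] assms(2)
    by (simp add: coframe_def matrix_vector_mul_assoc)
  then show ?thesis
    by (simp add: pullback_def coframe_def inj)
qed

text \<open>
  Both sides of the matrix equation are linear in the contact components of \<open>h\<close>, so its validity for all
  \<open>h\<close> is a comparison of coefficients. The last but one of the transformation equations is
  \<open>\<psi>\<^sub>u - \<chi> \<phi>\<^sub>u = b\<^sub>1\<close> multiplied by \<open>b\<^sub>9 = Dhat \<phi>\<close>.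
\<close>

lemma transition_iff_equations:
  assumes z: "z \<in> U"
  shows "(\<forall>h. contact_coframe fbar (prolong f \<phi> \<psi> z) (frechet_derivative (prolong f \<phi> \<psi>) (at z) h)
       = cofmat b *v contact_coframe f z h) \<longleftrightarrow>
    transformation_equations f fbar b \<phi> \<psi> z"
    (is "?match \<longleftrightarrow> ?equations")
proof -
  obtain x u p q where xupq: "z = (x,u,p,q)" by (cases z)
  define X \<eta> F where "X = chi f \<phi> \<psi>" and "\<eta> = eta f \<phi> \<psi>" and "F = fbar (prolong f \<phi> \<psi> z)"
  note defs = X_def \<eta>_def F_def
  let ?h = "\<lambda>k k1 k2 k3. (k, k1 + p * k, k2 + q * k, k3 + f z * k)"
  have expand: "frechet_derivative G (at z) (?h k k1 k2 k3)
      = k1 * d_u G z + k2 * d_p G z + k3 * d_q G z + k * Dhat f G z"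
    if "(G has_derivative frechet_derivative G (at z)) (at z)" for G k k1 k2 k3
    using differential_in_contact_coframe[of G _ x u p q k k1 k2 k3 "f z" f] that
    by (simp add: xupq)
  note d = prolong_differentials[OF z, THEN expand]
  have zero: "d_p (lift \<phi>) z = 0" "d_q (lift \<phi>) z = 0" "d_p (lift \<psi>) z = 0"
    "d_q (lift \<psi>) z = 0" "d_q X z = 0"
    unfolding X_def
    using d_p_lift[OF _ open_W base_in_W[OF z]] smooth
      has_total_derivative_imp(3)[OF has_total_derivative_lift[OF _ open_W base_in_W[OF z]]]
      has_total_derivative_imp(3)[OF has_total_derivative_chi[OF z]] by blast+
  \<comment> \<open>the contact components and dx are coordinates on the tangent space\<close>
  have all_h: "(\<forall>h. P h) \<longleftrightarrow> (\<forall>k k1 k2 k3. P (?h k k1 k2 k3))" for P :: "jet \<Rightarrow> bool"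
  proof
    assume P: "\<forall>k k1 k2 k3. P (?h k k1 k2 k3)"
    show "\<forall>h. P h"
    proof
      fix h :: jet
      obtain k l1 l2 l3 where h: "h = (k, l1, l2, l3)" by (cases h)
      show "P h"
        using P[rule_format, of k "l1 - p * k" "l2 - q * k" "l3 - f z * k"] by (simp add: h)
    qed
  qed simp
  \<comment> \<open>the rows are \<open>d\<psi> - \<chi> d\<phi>\<close>, \<open>d\<chi> - \<eta> d\<phi>\<close>, \<open>d\<eta> - fbar d\<phi>\<close> and \<open>d\<phi>\<close>\<close>
  have "?match \<longleftrightarrow> (\<forall>k k1 k2 k3.
      (k1 * d_u (lift \<psi>) z + k * Dhat f (lift \<psi>) z)
        - X z * (k1 * d_u (lift \<phi>) z + k * Dhat f (lift \<phi>) z) = b 1 * k1 \<and>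
      (k1 * d_u X z + k2 * d_p X z + k * Dhat f X z)
        - \<eta> z * (k1 * d_u (lift \<phi>) z + k * Dhat f (lift \<phi>) z) = b 2 * k1 + b 3 * k2 \<and>
      (k1 * d_u \<eta> z + k2 * d_p \<eta> z + k3 * d_q \<eta> z + k * Dhat f \<eta> z)
        - F * (k1 * d_u (lift \<phi>) z + k * Dhat f (lift \<phi>) z) = b 4 * k1 + b 5 * k2 + b 6 * k3 \<and>
      k1 * d_u (lift \<phi>) z + k * Dhat f (lift \<phi>) z = b 7 * k1 + b 9 * k)"
    unfolding all_h frechet_derivative_prolong[OF z] d
    by (simp add: xupq prolong_def contact_coframe_def cofmat_mult_vector vector_4 vec_eq_iff
        forall_4 defs zero[unfolded xupq defs])
  also have "\<dots> \<longleftrightarrow>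
     (d_u (lift \<psi>) z - X z * d_u (lift \<phi>) z = b 1 \<and>
      Dhat f (lift \<psi>) z = X z * Dhat f (lift \<phi>) z) \<and>
     (d_u X z - \<eta> z * d_u (lift \<phi>) z = b 2 \<and> d_p X z = b 3 \<and>
      Dhat f X z = \<eta> z * Dhat f (lift \<phi>) z) \<and>
     (d_u \<eta> z - F * d_u (lift \<phi>) z = b 4 \<and> d_p \<eta> z = b 5 \<and> d_q \<eta> z = b 6 \<and>
      Dhat f \<eta> z = F * Dhat f (lift \<phi>) z) \<and>
     (d_u (lift \<phi>) z = b 7 \<and> Dhat f (lift \<phi>) z = b 9)" (is "?L \<longleftrightarrow> ?R")
  proof
    assume L: ?L
    \<comment> \<open>evaluate on the four vectors of the dual frame\<close>
    show ?R
      using L[rule_format, of 1 0 0 0, simplified] L[rule_format, of 0 1 0 0, simplified]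
        L[rule_format, of 0 0 1 0, simplified] L[rule_format, of 0 0 0 1, simplified]
      unfolding One_nat_def by blast
  next
    assume R: ?R
    have b: "b 1 = d_u (lift \<psi>) z - X z * d_u (lift \<phi>) z"
      "b 2 = d_u X z - \<eta> z * d_u (lift \<phi>) z" "b 3 = d_p X z"
      "b 4 = d_u \<eta> z - F * d_u (lift \<phi>) z" "b 5 = d_p \<eta> z" "b 6 = d_q \<eta> z"
      "b 7 = d_u (lift \<phi>) z" "b 9 = Dhat f (lift \<phi>) z"
      using R by metis+
    have D: "Dhat f (lift \<psi>) z = X z * Dhat f (lift \<phi>) z"
      "Dhat f X z = \<eta> z * Dhat f (lift \<phi>) z" "Dhat f \<eta> z = F * Dhat f (lift \<phi>) z"
      using R by blast+
    show ?L
      unfolding b D by (simp add: algebra_simps)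
  qed
  also have "\<dots> \<longleftrightarrow> ?equations"
  proof -
    have nz: "Dhat f (lift \<phi>) z \<noteq> 0" using nonzero[OF z] .
    have \<psi>: "Dhat f (lift \<psi>) z = X z * Dhat f (lift \<phi>) z"
      using nz by (simp add: X_def chi_def)
    have X: "Dhat f X z = \<eta> z * Dhat f (lift \<phi>) z"
      using nz by (simp add: \<eta>_def eta_def X_def)
    show ?thesis
    proof (cases "Dhat f (lift \<phi>) z = b 9 \<and> d_u (lift \<phi>) z = b 7")
      case True
      have "b 9 * (b 7 * X z) = b 9 * (d_u (lift \<psi>) z - b 1) \<longleftrightarrow> d_u (lift \<psi>) z - X z * b 7 = b 1"
        by (subst mult_left_cancel) (use True nz in \<open>auto simp: algebra_simps\<close>)
      then have b1: "b 7 * (X z * b 9) = b 9 * (d_u (lift \<psi>) z - b 1)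
          \<longleftrightarrow> d_u (lift \<psi>) z - X z * b 7 = b 1"
        by (simp only: mult.left_commute[of "b 7"] mult.commute[of _ "b 9"])
      have move: "s - r * b 7 = c \<longleftrightarrow> s = c + b 7 * r" for s r c
        by (auto simp: algebra_simps)
      have quot: "F = Dhat f \<eta> z / b 9 \<longleftrightarrow> Dhat f \<eta> z = b 9 * F"
        using True nz by (auto simp: field_simps)
      show ?thesis
        unfolding transformation_equations_def Let_def defs[symmetric] \<psi> X
          True[THEN conjunct1] True[THEN conjunct2] b1 quot
        by (simp only: move mult.commute[of _ "b 9"]) blast
    next
      case False
      then show ?thesis
        unfolding transformation_equations_def Let_def by blast
    qed
  qed
  finally show ?thesis .
qed

lemma coframes_match_iff_determining_system:
  assumes "\<forall>z\<in>Ubar. abar 1 z * abar 3 z * abar 6 z * abar 9 z \<noteq> 0"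
  shows "coframes_match f U fbar a abar \<phi> \<psi> \<longleftrightarrow> determining_system f U fbar a abar \<phi> \<psi>"
  unfolding coframes_match_def determining_system_iff Let_def
proof (rule ball_cong[OF refl])
  fix z assume z: "z \<in> U"
  let ?B = "transition a abar (prolong f \<phi> \<psi>) z"
  note abar = assms[rule_format, OF prolong_in_Ubar[OF z]]
  have B: "?B = cofmat (cofentry ?B)"
    using abar by (rule transition_eq(2))
  have "(\<forall>h. pullback (prolong f \<phi> \<psi>) (coframe fbar abar) z h = coframe f a z h) \<longleftrightarrow>
    (\<forall>h. contact_coframe fbar (prolong f \<phi> \<psi> z) (frechet_derivative (prolong f \<phi> \<psi>) (at z) h)
     = cofmat (cofentry ?B) *v contact_coframe f z h)"
    by (simp only: coframe_match_iff_transition[OF z, of abar, OF abar] B[symmetric])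
  also have "\<dots> \<longleftrightarrow> transformation_equations f fbar (cofentry ?B) \<phi> \<psi> z"
    by (rule transition_iff_equations[OF z])
  finally show "(\<forall>h. pullback (prolong f \<phi> \<psi>) (coframe fbar abar) z h = coframe f a z h) \<longleftrightarrow>
    ?B = cofmat (cofentry ?B) \<and> transformation_equations f fbar (cofentry ?B) \<phi> \<psi> z"
    using B by blast
qed

text \<open>
  The nonvanishing of \<open>\<eta>\<^sub>q = b\<^sub>6\<close> comes from the third diagonal entry of the matrix identity that
  defines \<open>b\<close>: \<open>abar\<^sub>6 b\<^sub>6 = a\<^sub>6\<close>.
\<close>

lemma ode_equivalent_if_determining_system:
  assumes a: "\<forall>z\<in>U. a 1 z * a 3 z * a 6 z * a 9 z \<noteq> 0"
    and abar: "\<forall>z\<in>Ubar. abar 1 z * abar 3 z * abar 6 z * abar 9 z \<noteq> 0"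
    and sys: "determining_system f U fbar a abar \<phi> \<psi>"
  shows "ode_equivalent f U fbar Ubar \<phi> \<psi>"
proof (rule ode_equivalent_if_third_derivative)
  fix z assume z: "z \<in> U"
  let ?\<Phi> = "prolong f \<phi> \<psi>"
  let ?B = "transition a abar ?\<Phi> z"
  have s: "transformation_equations f fbar (cofentry ?B) \<phi> \<psi> z"
    using sys z by (simp add: determining_system_iff Let_def)
  show "fbar (?\<Phi> z) = Dhat f (eta f \<phi> \<psi>) z / Dhat f (lift \<phi>) z"
    using s[unfolded transformation_equations_def Let_def] by blast
  note nz = abar[rule_format, OF prolong_in_Ubar[OF z]]
  have "?B = cofmat (cofentry ?B)"
    using nz by (rule transition_eq(2))
  then have "cofmat (\<lambda>i. abar i (?\<Phi> z)) ** cofmat (cofentry ?B) = cofmat (\<lambda>i. abar i (?\<Phi> z)) ** ?B"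
    by (rule arg_cong[OF sym])
  also have "\<dots> = cofmat (\<lambda>i. a i z)"
    using nz by (rule transition_eq(1))
  finally have "abar 6 (?\<Phi> z) * cofentry ?B 6 = a 6 z"
    using cofmat_mult_6[of "\<lambda>i. abar i (?\<Phi> z)" "cofentry ?B"] by (simp add: cofmat_def vector_4)
  moreover have "d_q (eta f \<phi> \<psi>) z = cofentry ?B 6"
    using s[unfolded transformation_equations_def Let_def] by blast
  ultimately show "d_q (eta f \<phi> \<psi>) z \<noteq> 0"
    using a z by auto
qed

end

theorem proposition4p1:
  fixes f fbar :: "jet \<Rightarrow> real" and U Ubar :: "jet set" and W :: "plane set"
    and a abar :: "nat \<Rightarrow> jet \<Rightarrow> real" and \<phi> \<psi> :: "plane \<Rightarrow> real"
  assumes "open U" and "open Ubar" and "open W" and "base ` U \<subseteq> W"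
    and "\<forall>z\<in>U. a 1 z * a 3 z * a 6 z * a 9 z \<noteq> 0"
    and "\<forall>z\<in>Ubar. abar 1 z * abar 3 z * abar 6 z * abar 9 z \<noteq> 0"
    and "point_transformation W \<phi> \<psi>"
    and "prolongs_into f \<phi> \<psi> U Ubar"
    and "ode_equivalent f U fbar Ubar \<phi> \<psi>"
    and "coframes_match f U fbar a abar \<phi> \<psi>"
  shows "determining_system f U fbar a abar \<phi> \<psi> \<and>
    (\<forall>\<phi>' \<psi>'. point_transformation W \<phi>' \<psi>' \<and> prolongs_into f \<phi>' \<psi>' U Ubar \<and>
        determining_system f U fbar a abar \<phi>' \<psi>' \<longrightarrow>
        ode_equivalent f U fbar Ubar \<phi>' \<psi>' \<and> coframes_match f U fbar a abar \<phi>' \<psi>')"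
proof -
  have prolongable: "prolongable f U Ubar W \<phi>' \<psi>'"
    if "point_transformation W \<phi>' \<psi>'" "prolongs_into f \<phi>' \<psi>' U Ubar" for \<phi>' \<psi>'
    using that assms(1,3,4) by unfold_locales (simp_all add: point_transformation_def)
  note iff = prolongable.coframes_match_iff_determining_system[OF prolongable assms(6)]
  note equiv = prolongable.ode_equivalent_if_determining_system[OF prolongable assms(5,6)]
  show ?thesis
  proof (intro conjI allI impI)
    show "determining_system f U fbar a abar \<phi> \<psi>"
      using iff[OF assms(7,8)] assms(10) by blast
  next
    fix \<phi>' \<psi>'
    assume *: "point_transformation W \<phi>' \<psi>' \<and> prolongs_into f \<phi>' \<psi>' U Ubar \<and>
        determining_system f U fbar a abar \<phi>' \<psi>'"
    then show "ode_equivalent f U fbar Ubar \<phi>' \<psi>'"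
      using equiv by blast
    show "coframes_match f U fbar a abar \<phi>' \<psi>'"
      using iff * by blast
  qed
qed

end
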